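(* Let $f\in L^1(\mathbb{R}^N)$ be nonnegative a.e. and compactly supported, and let $u$ be the $L^1$-solution of the nonlocal Stefan problem $\partial_t u=J*v-v$, $v=(u-1)_+$, $u(\cdot,0)=f$. Then, for any $t>0$, the solution $u(t)$ and the corresponding temperature $v(t)=(u(t)-1)_+$ are compactly supported.
   Context: Standing assumptions: $J:\mathbb{R}^N\to[0,\infty)$ is continuous, compactly supported, radially symmetric, and $\int_{\mathbb{R}^N}J=1$. Here $*$ is convolution in space and $s_+=\max\{s,0\}$. For $f\in L^1(\mathbb{R}^N)$, the $L^1$-solution is the unique $u\in C([0,\infty);L^1(\mathbb{R}^N))$ such that for every $t>0$, $u(t)=f+\int_0^t(J*v(s)-v(s))\,ds$ with $v=(u-1)_+$ a.e. Supports of locally integrable functions are understood in the distributional sense: the support of $g$ is the complement of the largest open set on which $g=0$ a.e. *)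

theory Defs
  imports "HOL-Analysis.Analysis"
begin

section \<open>The Banach space of integrable functions modulo equality almost everywhere\<close>

definition L1_rel :: "('a::euclidean_space \<Rightarrow> real) \<Rightarrow> ('a \<Rightarrow> real) \<Rightarrow> bool" where
  "L1_rel f g \<longleftrightarrow> integrable lborel f \<and> integrable lborel g \<and> (AE x in lborel. f x = g x)"

quotient_type (overloaded) 'a L1 = "'a::euclidean_space \<Rightarrow> real" / partial: L1_rel
  morphisms rep_L1 L1_of
proof (rule part_equivpI)
  show "\<exists>f. L1_rel f f"
    by (rule exI[of _ "\<lambda>_. 0"]) (simp add: L1_rel_def)
  show "symp L1_rel"
    by (auto simp: symp_def L1_rel_def eq_commute)
  show "transp L1_rel"
    unfolding transp_def L1_rel_def by (auto elim: eventually_elim2)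
qed

instantiation L1 :: (euclidean_space) real_vector
begin

lift_definition zero_L1 :: "'a L1" is "\<lambda>_. 0"
  by (simp add: L1_rel_def)

lift_definition plus_L1 :: "'a L1 \<Rightarrow> 'a L1 \<Rightarrow> 'a L1" is "\<lambda>f g x. f x + g x"
  unfolding L1_rel_def by (auto elim: eventually_elim2)

lift_definition minus_L1 :: "'a L1 \<Rightarrow> 'a L1 \<Rightarrow> 'a L1" is "\<lambda>f g x. f x - g x"
  unfolding L1_rel_def by (auto elim: eventually_elim2)

lift_definition uminus_L1 :: "'a L1 \<Rightarrow> 'a L1" is "\<lambda>f x. - f x"
  unfolding L1_rel_def by auto

lift_definition scaleR_L1 :: "real \<Rightarrow> 'a L1 \<Rightarrow> 'a L1" is "\<lambda>c f x. c * f x"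
  unfolding L1_rel_def by auto

instance
proof
  fix f g h :: "'a L1" and a b :: real
  show "f + g + h = f + (g + h)" by transfer (simp add: L1_rel_def algebra_simps)
  show "f + g = g + f" by transfer (simp add: L1_rel_def algebra_simps)
  show "0 + f = f" by transfer (simp add: L1_rel_def)
  show "- f + f = 0" by transfer (simp add: L1_rel_def)
  show "f - g = f + - g" by transfer (simp add: L1_rel_def)
  show "a *\<^sub>R (f + g) = a *\<^sub>R f + a *\<^sub>R g" by transfer (simp add: L1_rel_def algebra_simps)
  show "(a + b) *\<^sub>R f = a *\<^sub>R f + b *\<^sub>R f" by transfer (simp add: L1_rel_def algebra_simps)
  show "a *\<^sub>R b *\<^sub>R f = (a * b) *\<^sub>R f" by transfer (simp add: L1_rel_def algebra_simps)
  show "1 *\<^sub>R f = f" by transfer (simp add: L1_rel_def)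
qed

end

instantiation L1 :: (euclidean_space) real_normed_vector
begin

lift_definition norm_L1 :: "'a L1 \<Rightarrow> real" is "\<lambda>f. \<integral>x. \<bar>f x\<bar> \<partial>lborel"
  unfolding L1_rel_def by (auto intro!: integral_cong_AE)

definition dist_L1 :: "'a L1 \<Rightarrow> 'a L1 \<Rightarrow> real" where
  "dist_L1 f g = norm (f - g)"

definition sgn_L1 :: "'a L1 \<Rightarrow> 'a L1" where
  "sgn_L1 f = f /\<^sub>R norm f"

definition uniformity_L1 :: "('a L1 \<times> 'a L1) filter" where
  "uniformity_L1 = (INF e\<in>{0<..}. principal {(f, g). dist f g < e})"

definition open_L1 :: "'a L1 set \<Rightarrow> bool" where
  "open_L1 U \<longleftrightarrow> (\<forall>f\<in>U. \<forall>\<^sub>F (f', g) in uniformity. f' = f \<longrightarrow> g \<in> U)"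

instance
proof
  fix f g :: "'a L1" and a :: real
  show "dist f g = norm (f - g)" by (rule dist_L1_def)
  show "sgn f = f /\<^sub>R norm f" by (rule sgn_L1_def)
  show "uniformity = (INF e\<in>{0<..}. principal {(f, g::'a L1). dist f g < e})"
    by (rule uniformity_L1_def)
  show "open U \<longleftrightarrow> (\<forall>f\<in>U. \<forall>\<^sub>F (f', g) in uniformity. f' = f \<longrightarrow> g \<in> U)" for U :: "'a L1 set"
    by (rule open_L1_def)
  show "norm f = 0 \<longleftrightarrow> f = 0"
    by transfer (simp add: L1_rel_def integral_nonneg_eq_0_iff_AE)
  show "norm (a *\<^sub>R f) = \<bar>a\<bar> * norm f"
    by transfer (simp add: abs_mult)
  show "norm (f + g) \<le> norm f + norm g"
  proof transfer
    fix f g :: "'a \<Rightarrow> real"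
    assume "L1_rel f f" "L1_rel g g"
    then have fg: "integrable lborel f" "integrable lborel g"
      by (auto simp: L1_rel_def)
    have "(\<integral>x. \<bar>f x + g x\<bar> \<partial>lborel) \<le> (\<integral>x. \<bar>f x\<bar> + \<bar>g x\<bar> \<partial>lborel)"
      by (rule integral_mono) (use fg in \<open>auto intro: abs_triangle_ineq\<close>)
    also have "\<dots> = (\<integral>x. \<bar>f x\<bar> \<partial>lborel) + (\<integral>x. \<bar>g x\<bar> \<partial>lborel)"
      using fg by simp
    finally show "(\<integral>x. \<bar>f x + g x\<bar> \<partial>lborel) \<le> (\<integral>x. \<bar>f x\<bar> \<partial>lborel) + (\<integral>x. \<bar>g x\<bar> \<partial>lborel)" .
  qed
qed

end

lemma integrable_rep_L1: "integrable lborel (rep_L1 f)"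
  using Quotient3_rep_reflp[OF Quotient3_L1] by (auto simp: L1_rel_def)

lemma L1_of_rep: "L1_of (rep_L1 f) = f"
  by (rule Quotient3_abs_rep[OF Quotient3_L1])

lemma L1_of_eq_iff:
  assumes "integrable lborel f" "integrable lborel g"
  shows "L1_of f = L1_of g \<longleftrightarrow> (AE x in lborel. f x = g x)"
  using Quotient3_rel[OF Quotient3_L1, of f g] assms by (auto simp: L1_rel_def)

lemma rep_L1_of:
  assumes "integrable lborel f"
  shows "AE x in lborel. rep_L1 (L1_of f) x = f x"
  using L1_of_eq_iff[OF integrable_rep_L1 assms, of "L1_of f"] by (simp add: L1_of_rep)

lemma norm_L1_of:
  assumes "integrable lborel f"
  shows "norm (L1_of f) = (\<integral>x. \<bar>f x\<bar> \<partial>lborel)"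
  using assms by (intro norm_L1.abs_eq) (simp add: L1_rel_def)

lemma L1_of_diff:
  assumes "integrable lborel f" "integrable lborel g"
  shows "L1_of f - L1_of g = L1_of (\<lambda>x. f x - g x)"
  using assms by (intro minus_L1.abs_eq) (simp_all add: L1_rel_def)

instance L1 :: (euclidean_space) banach
proof
  fix X :: "nat \<Rightarrow> 'a L1"
  assume X: "Cauchy X"
  have "\<exists>r::nat \<Rightarrow> nat. \<forall>k. (\<forall>m\<ge>r k. norm (X m - X (r k)) < (1/2)^k) \<and> r k < r (Suc k)"
  proof (rule dependent_nat_choice)
    show "\<exists>x. \<forall>m\<ge>x. norm (X m - X x) < (1/2)^0"
      using X[unfolded Cauchy_def dist_norm, rule_format, of "(1/2)^0"] by auto
    show "\<exists>y. (\<forall>m\<ge>y. norm (X m - X y) < (1/2)^Suc n) \<and> x < y" for x n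
    proof -
      obtain M where "\<forall>m\<ge>M. \<forall>n'\<ge>M. norm (X m - X n') < (1/2)^Suc n"
        using X[unfolded Cauchy_def dist_norm, rule_format, of "(1/2)^Suc n"] by auto
      then show ?thesis by (intro exI[of _ "max M (Suc x)"]) auto
    qed
  qed
  then obtain r :: "nat \<Rightarrow> nat"
    where r: "\<And>k m. m \<ge> r k \<Longrightarrow> norm (X m - X (r k)) < (1/2)^k" and r_less: "\<And>k. r k < r (Suc k)"
    by blast
  have mono: "strict_mono r"
    using r_less by (simp add: strict_mono_Suc_iff)
  define F where "F k = rep_L1 (X (r k))" for k
  have F[intro, simp]: "integrable lborel (F k)" for k
    by (simp add: F_def integrable_rep_L1)
  have F_of: "L1_of (F k) = X (r k)" for k
    by (simp add: F_def L1_of_rep)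
  define g where "g k x = F (Suc k) x - F k x" for k x
  have g[intro, simp]: "integrable lborel (g k)" for k
    unfolding g_def by auto
  have g_le: "(\<integral>x. \<bar>g k x\<bar> \<partial>lborel) \<le> (1/2)^k" for k
  proof -
    have "(\<integral>x. \<bar>g k x\<bar> \<partial>lborel) = norm (X (r (Suc k)) - X (r k))"
      by (simp add: F_of[symmetric] L1_of_diff norm_L1_of g_def)
    also have "\<dots> < (1/2)^k"
      using r_less[of k] by (intro r) simp
    finally show ?thesis by simp
  qed
  have sum_int: "summable (\<lambda>k. \<integral>x. \<bar>g k x\<bar> \<partial>lborel)"
    by (rule summable_comparison_test'[of "\<lambda>k. (1/2::real)^k" 0]) (use g_le in \<open>auto simp: summable_geometric\<close>)
  have "(\<integral>\<^sup>+x. (\<Sum>k. ennreal \<bar>g k x\<bar>) \<partial>lborel) = (\<Sum>k. \<integral>\<^sup>+x. ennreal \<bar>g k x\<bar> \<partial>lborel)"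
    by (rule nn_integral_suminf) (use borel_measurable_integrable[OF g] in measurable)
  also have "\<dots> = (\<Sum>k. ennreal (\<integral>x. \<bar>g k x\<bar> \<partial>lborel))"
    by (intro suminf_cong nn_integral_eq_integral) auto
  also have "\<dots> \<noteq> \<infinity>"
    using sum_int by (auto simp: ennreal_suminf_neq_top)
  finally have "AE x in lborel. (\<Sum>k. ennreal \<bar>g k x\<bar>) \<noteq> \<infinity>"
    by (intro nn_integral_noteq_infinite) (use borel_measurable_integrable[OF g] in measurable)
  then have AE_sum: "AE x in lborel. summable (\<lambda>k. norm (g k x))"
    by eventually_elim (auto intro: summable_suminf_not_top)
  have int_w: "integrable lborel (\<lambda>x. \<Sum>k. \<bar>g k x\<bar>)"
    by (rule integrable_suminf) (use AE_sum sum_int in auto)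
  have int_S: "integrable lborel (\<lambda>x. \<Sum>k. g k x)"
    by (rule integrable_suminf) (use AE_sum sum_int in auto)
  define L where "L x = F 0 x + (\<Sum>k. g k x)" for x
  have int_L: "integrable lborel L"
    unfolding L_def using int_S by auto
  have F_sum: "F n x = F 0 x + (\<Sum>k<n. g k x)" for n x
    by (induction n) (simp_all add: g_def)
  have "(\<lambda>n. \<integral>x. \<bar>F n x - L x\<bar> \<partial>lborel) \<longlonglongrightarrow> (\<integral>x. 0 \<partial>(lborel :: 'a measure))"
  proof (rule integral_dominated_convergence[where w="\<lambda>x. 2 * (\<Sum>k. \<bar>g k x\<bar>)"])
    show "(\<lambda>x. 0) \<in> borel_measurable lborel"
      by simp
    show "(\<lambda>x. \<bar>F n x - L x\<bar>) \<in> borel_measurable lborel" for n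
      by (intro borel_measurable_integrable integrable_abs Bochner_Integration.integrable_diff F int_L)
    show "integrable lborel (\<lambda>x. 2 * (\<Sum>k. \<bar>g k x\<bar>))"
      using int_w by auto
    show "AE x in lborel. (\<lambda>n. \<bar>F n x - L x\<bar>) \<longlonglongrightarrow> 0"
      using AE_sum
    proof eventually_elim
      case (elim x)
      have "(\<lambda>n. F 0 x + (\<Sum>k<n. g k x)) \<longlonglongrightarrow> L x"
        unfolding L_def by (intro tendsto_intros summable_LIMSEQ summable_norm_cancel[OF elim])
      then have "(\<lambda>n. F n x) \<longlonglongrightarrow> L x"
        by (simp add: F_sum[symmetric])
      then show ?case
        by (simp add: LIM_zero tendsto_rabs_zero)
    qed
    show "AE x in lborel. norm \<bar>F n x - L x\<bar> \<le> 2 * (\<Sum>k. \<bar>g k x\<bar>)" for n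
      using AE_sum
    proof eventually_elim
      case (elim x)
      have 1: "\<bar>\<Sum>k. g k x\<bar> \<le> (\<Sum>k. \<bar>g k x\<bar>)"
        using summable_norm[OF elim] by simp
      have "\<bar>\<Sum>k<n. g k x\<bar> \<le> (\<Sum>k<n. \<bar>g k x\<bar>)"
        by (rule sum_abs)
      also have "\<dots> \<le> (\<Sum>k. \<bar>g k x\<bar>)"
        using elim by (intro sum_le_suminf) auto
      finally have 2: "\<bar>\<Sum>k<n. g k x\<bar> \<le> (\<Sum>k. \<bar>g k x\<bar>)" .
      have "F n x - L x = (\<Sum>k<n. g k x) - (\<Sum>k. g k x)"
        using F_sum[of n x] by (simp add: L_def)
      then show ?case using 1 2 by simp
    qed
  qed
  then have "(\<lambda>n. norm (X (r n) - L1_of L)) \<longlonglongrightarrow> 0"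
    by (simp add: F_of[symmetric] L1_of_diff norm_L1_of int_L)
  then have "(X \<circ> r) \<longlonglongrightarrow> L1_of L"
    by (simp add: o_def LIM_zero_iff tendsto_norm_zero_iff)
  with X mono have "X \<longlonglongrightarrow> L1_of L"
    by (rule Cauchy_converges_subseq)
  then show "convergent X" by (auto simp: convergent_def)
qed


section \<open>Convolution\<close>

lemma lborel_distr_reflect: "distr lborel borel (\<lambda>y. x - y) = (lborel :: 'a::euclidean_space measure)"
  using lborel_affine[of "-1" x] by (simp add: density_1)

lemma integrable_convolution:
  fixes f g :: "'a::euclidean_space \<Rightarrow> real"
  assumes f: "integrable lborel f" and g: "integrable lborel g"
  shows "integrable lborel (\<lambda>x. \<integral>y. f (x - y) * g y \<partial>lborel)"
proof -
  have [measurable]: "f \<in> borel_measurable borel" "g \<in> borel_measurable borel"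
    using f g by auto
  have shift: "(\<lambda>x. x - y) = (+) (- y)" for y :: 'a
    by (rule ext) simp
  have trans: "distr lborel borel (\<lambda>x. x - y) = (lborel :: 'a measure)" for y :: 'a
    unfolding shift by (rule lborel_distr_plus)
  have int_trans: "integrable lborel (\<lambda>x. f (x - y))" for y
    using integrable_distr_eq[of "\<lambda>x. x - y" lborel borel f] f by (simp add: trans)
  have norm_trans: "(\<integral>x. \<bar>f (x - y)\<bar> \<partial>lborel) = (\<integral>x. \<bar>f x\<bar> \<partial>lborel)" for y
    using integral_distr[of "\<lambda>x. x - y" lborel borel "\<lambda>x. \<bar>f x\<bar>"] by (simp add: trans)
  have "integrable (lborel \<Otimes>\<^sub>M lborel) (\<lambda>(y, x). f (x - y) * g y)"
  proof (rule lborel_pair.Fubini_integrable)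
    show "(\<lambda>(y, x). f (x - y) * g y) \<in> borel_measurable (lborel \<Otimes>\<^sub>M lborel)"
      by measurable
    show "integrable lborel (\<lambda>y. \<integral>x. norm (case (y, x) of (y, x) \<Rightarrow> f (x - y) * g y) \<partial>lborel)"
      using g by (simp add: abs_mult norm_trans)
    show "AE y in lborel. integrable lborel (\<lambda>x. case (y, x) of (y, x) \<Rightarrow> f (x - y) * g y)"
      by (simp add: int_trans)
  qed
  from lborel_pair.integrable_product_swap[OF this]
  have "integrable (lborel \<Otimes>\<^sub>M lborel) (\<lambda>(x, y). f (x - y) * g y)"
    by (simp add: case_prod_unfold)
  from lborel_pair.integrable_fst[OF this] show ?thesis by simp
qed

lemma convolution_cong_AE:
  fixes f f' g g' :: "'a::euclidean_space \<Rightarrow> real"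
  assumes [measurable]: "f \<in> borel_measurable borel" "f' \<in> borel_measurable borel"
      "g \<in> borel_measurable borel" "g' \<in> borel_measurable borel"
    and f: "AE x in lborel. f x = f' x" and g: "AE x in lborel. g x = g' x"
  shows "(\<integral>y. f (x - y) * g y \<partial>lborel) = (\<integral>y. f' (x - y) * g' y \<partial>lborel)"
proof (rule integral_cong_AE)
  have "AE z in distr lborel borel (\<lambda>y. x - y). f z = f' z"
    unfolding lborel_distr_reflect by (rule f)
  then have "AE y in lborel. f (x - y) = f' (x - y)"
    by (subst (asm) AE_distr_iff) (auto intro!: borel_measurable_diff)
  with g show "AE y in lborel. f (x - y) * g y = f' (x - y) * g' y"
    by eventually_elim simp
qed measurable

lift_definition L1_conv :: "'a::euclidean_space L1 \<Rightarrow> 'a L1 \<Rightarrow> 'a L1" (infixl "\<star>" 70)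
  is "\<lambda>f g x. \<integral>y. f (x - y) * g y \<partial>lborel"
  unfolding L1_rel_def
  by (auto intro!: integrable_convolution AE_I2 convolution_cong_AE)


section \<open>Supports and sign\<close>

text \<open>The distributional support: the complement of the largest open set on which \<open>g\<close> vanishes
  almost everywhere. The lemma after the definition shows that the union is itself such a set.\<close>

definition ae_support :: "('a::euclidean_space \<Rightarrow> real) \<Rightarrow> 'a set" where
  "ae_support g = - \<Union>{U. open U \<and> (AE x in lborel. x \<in> U \<longrightarrow> g x = 0)}"

lemma ae_support_vanishes:
  "open (- ae_support g)" "AE x in lborel. x \<in> - ae_support g \<longrightarrow> g x = 0"
proof -
  let ?\<F> = "{U. open U \<and> (AE x in lborel. x \<in> U \<longrightarrow> g x = 0)}"
  show "open (- ae_support g)"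
    unfolding ae_support_def by auto
  obtain \<D> where \<D>: "\<D> \<subseteq> ?\<F>" "countable \<D>" "\<Union>\<D> = \<Union>?\<F>"
    using Lindelof[of ?\<F>] by blast
  have "AE x in lborel. \<forall>U\<in>\<D>. x \<in> U \<longrightarrow> g x = 0"
    using \<D> by (subst AE_ball_countable) auto
  then show "AE x in lborel. x \<in> - ae_support g \<longrightarrow> g x = 0"
    unfolding ae_support_def double_complement \<D>(3)[symmetric]
    by eventually_elim auto
qed

lemma ae_support_cong_AE:
  assumes "AE x in lborel. f x = g x"
  shows "ae_support f = ae_support g"
proof -
  have "(AE x in lborel. x \<in> U \<longrightarrow> f x = 0) \<longleftrightarrow> (AE x in lborel. x \<in> U \<longrightarrow> g x = 0)" for U
    using assms by (intro eventually_subst) (auto elim: eventually_mono)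
  then show ?thesis unfolding ae_support_def by simp
qed

lemma ae_support_continuous:
  fixes g :: "'a::euclidean_space \<Rightarrow> real"
  assumes g: "continuous_on UNIV g"
  shows "ae_support g = closure {x. g x \<noteq> 0}"
proof -
  have op: "open {x. g x \<noteq> 0}"
    using g by (intro open_Collect_neq) auto
  have "(AE x in lborel. x \<in> U \<longrightarrow> g x = 0) \<longleftrightarrow> U \<inter> {x. g x \<noteq> 0} = {}" if "open U" for U
  proof
    assume "AE x in lborel. x \<in> U \<longrightarrow> g x = 0"
    then have "AE x in lborel. x \<notin> U \<inter> {x. g x \<noteq> 0}"
      by eventually_elim auto
    then have "U \<inter> {x. g x \<noteq> 0} \<in> null_sets lborel"
      using op that by (subst AE_iff_null_sets) auto
    then have "negligible (U \<inter> {x. g x \<noteq> 0})"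
      by (simp add: negligible_iff_null_sets null_sets_completionI)
    then show "U \<inter> {x. g x \<noteq> 0} = {}"
      using open_not_negligible[of "U \<inter> {x. g x \<noteq> 0}"] op that by auto
  qed (auto intro!: AE_I2)
  then have "{U. open U \<and> (AE x in lborel. x \<in> U \<longrightarrow> g x = 0)} = {U. open U \<and> U \<subseteq> - {x. g x \<noteq> 0}}"
    by auto
  then have "\<Union>{U. open U \<and> (AE x in lborel. x \<in> U \<longrightarrow> g x = 0)} = interior (- {x. g x \<noteq> 0})"
    by (auto simp: interior_def)
  then show ?thesis
    unfolding ae_support_def by (simp only: interior_complement double_complement)
qed

lift_definition L1_support :: "'a::euclidean_space L1 \<Rightarrow> 'a set" is ae_support
  by (simp add: L1_rel_def ae_support_cong_AE)

lift_definition L1_nonneg :: "'a::euclidean_space L1 \<Rightarrow> bool" is "\<lambda>f. AE x in lborel. 0 \<le> f x"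
  unfolding L1_rel_def by (auto elim: eventually_elim2)


section \<open>The nonlocal Stefan problem\<close>

lift_definition temperature :: "'a::euclidean_space L1 \<Rightarrow> 'a L1" is "\<lambda>u x. max (u x - 1) 0"
proof -
  have int: "integrable lborel (\<lambda>x. max (u x - 1) 0)"
    if "integrable lborel u" for u :: "'a \<Rightarrow> real"
    by (rule Bochner_Integration.integrable_bound[OF that]) (use that in auto)
  fix u u' :: "'a \<Rightarrow> real"
  assume "L1_rel u u'"
  then show "L1_rel (\<lambda>x. max (u x - 1) 0) (\<lambda>x. max (u' x - 1) 0)"
    unfolding L1_rel_def by (auto intro: int)
qed

text \<open>Only the values of \<open>u\<close> on \<open>[0, \<infinity>)\<close> matter. The time integral is the integral of an
  \<open>L1\<close>-valued function, which is continuous in time, so that all the usual notions of a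
  Banach-space-valued integral agree. Letting \<open>t\<close> tend to \<open>0\<close> gives \<open>u 0 = f\<close>.\<close>

definition L1_solution :: "('a::euclidean_space \<Rightarrow> real) \<Rightarrow> 'a L1 \<Rightarrow> (real \<Rightarrow> 'a L1) \<Rightarrow> bool" where
  "L1_solution J f u \<longleftrightarrow> continuous_on {0..} u \<and>
     (\<forall>t>0. u t = f + integral {0..t} (\<lambda>s. L1_of J \<star> temperature (u s) - temperature (u s)))"

end

theory Submission
  imports Defs
begin

text \<open>On \<open>[0, t]\<close> the temperature \<open>v\<close> is bounded in \<open>L\<^sup>1\<close> by some \<open>M\<close>, so \<open>J * v - v \<le> c\<close>
  with \<open>c = M sup J\<close>. Off a compact set \<open>K\<close> carrying \<open>u(a)\<close> we therefore have \<open>u(s) \<le> (s - a) c\<close>,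
  which does not exceed the melting threshold \<open>1\<close> during a time span of length \<open>1 / c\<close>.
  Hence \<open>v\<close> vanishes off \<open>K\<close> during that span, \<open>J * v\<close> vanishes off \<open>K + supp J\<close>, and \<open>u\<close> stays
  carried by \<open>K \<union> (K + supp J)\<close>. Finitely many such spans of equal length cover \<open>[0, t]\<close>.\<close>

section \<open>Almost-everywhere representatives\<close>

lemma rep_L1_borel [measurable]: "rep_L1 f \<in> borel_measurable borel"
  using integrable_rep_L1[of f] by auto

text \<open>\<open>rep_L1\<close> picks an arbitrary representative of a class, so it respects the
  operations on classes only up to a null set.\<close>

lemma rep_L1_add: "AE x in lborel. rep_L1 (f + g) x = rep_L1 f x + rep_L1 g x"
proof -
  have "f + g = L1_of (\<lambda>x. rep_L1 f x + rep_L1 g x)"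
    using plus_L1.abs_eq[of "rep_L1 f" "rep_L1 g"]
    by (simp add: L1_rel_def integrable_rep_L1 L1_of_rep)
  then show ?thesis
    using rep_L1_of[of "\<lambda>x. rep_L1 f x + rep_L1 g x"] by (simp add: integrable_rep_L1)
qed

lemma rep_L1_diff: "AE x in lborel. rep_L1 (f - g) x = rep_L1 f x - rep_L1 g x"
proof -
  have "f - g = L1_of (\<lambda>x. rep_L1 f x - rep_L1 g x)"
    using L1_of_diff[of "rep_L1 f" "rep_L1 g"] by (simp add: integrable_rep_L1 L1_of_rep)
  then show ?thesis
    using rep_L1_of[of "\<lambda>x. rep_L1 f x - rep_L1 g x"] by (simp add: integrable_rep_L1)
qed

lemma rep_L1_scaleR: "AE x in lborel. rep_L1 (r *\<^sub>R f) x = r * rep_L1 f x"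
proof -
  have "r *\<^sub>R f = L1_of (\<lambda>x. r * rep_L1 f x)"
    using scaleR_L1.abs_eq[of "rep_L1 f" r] by (simp add: L1_rel_def integrable_rep_L1 L1_of_rep)
  then show ?thesis
    using rep_L1_of[of "\<lambda>x. r * rep_L1 f x"] by (simp add: integrable_rep_L1)
qed

lemma norm_L1_rep: "norm f = (\<integral>x. \<bar>rep_L1 f x\<bar> \<partial>lborel)"
  using norm_L1_of[OF integrable_rep_L1, of f] by (simp add: L1_of_rep)

lemma rep_L1_temperature: "AE x in lborel. rep_L1 (temperature f) x = max (rep_L1 f x - 1) 0"
proof -
  have int: "integrable lborel (\<lambda>x. max (rep_L1 f x - 1) 0)"
    by (rule Bochner_Integration.integrable_bound[OF integrable_rep_L1[of f]]) auto
  have "temperature f = L1_of (\<lambda>x. max (rep_L1 f x - 1) 0)"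
    using temperature.abs_eq[of "rep_L1 f"] by (simp add: L1_rel_def integrable_rep_L1 L1_of_rep)
  then show ?thesis
    using rep_L1_of[OF int] by simp
qed

lemma norm_temperature_le: "norm (temperature f) \<le> norm f"
  unfolding norm_L1_rep
proof (rule integral_mono_AE)
  show "AE x in lborel. \<bar>rep_L1 (temperature f) x\<bar> \<le> \<bar>rep_L1 f x\<bar>"
    using rep_L1_temperature[of f] by eventually_elim auto
qed (simp_all add: integrable_rep_L1)

section \<open>Size and support of a convolution\<close>

lemma rep_L1_conv:
  assumes "integrable lborel J"
  shows "AE x in lborel. rep_L1 (L1_of J \<star> g) x = (\<integral>y. J (x - y) * rep_L1 g y \<partial>lborel)"
proof -
  have "L1_of J \<star> g = L1_of (\<lambda>x. \<integral>y. J (x - y) * rep_L1 g y \<partial>lborel)"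
    using L1_conv.abs_eq[of J "rep_L1 g"] assms
    by (simp add: L1_rel_def integrable_rep_L1 L1_of_rep)
  then show ?thesis
    using rep_L1_of[OF integrable_convolution[OF assms integrable_rep_L1]] by simp
qed

text \<open>The integrand is at most \<open>B * \<bar>rep_L1 g y\<bar>\<close>, uniformly in
  \<open>x\<close>. Applied to the temperature, this bounds the rate at which \<open>u\<close> can
  grow.\<close>

lemma rep_L1_conv_le:
  assumes J: "integrable lborel J" and B: "\<And>x. \<bar>J x\<bar> \<le> B"
  shows "AE x in lborel. rep_L1 (L1_of J \<star> g) x \<le> B * norm g"
  using rep_L1_conv[OF J, of g]
proof eventually_elim
  case (elim x)
  have [measurable]: "J \<in> borel_measurable borel"
    using J by auto
  have "(\<integral>y. J (x - y) * rep_L1 g y \<partial>lborel) \<le> (\<integral>y. B * \<bar>rep_L1 g y\<bar> \<partial>lborel)"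
  proof (rule integral_mono)
    have le: "\<bar>J (x - y) * rep_L1 g y\<bar> \<le> B * \<bar>rep_L1 g y\<bar>" for y
      using B[of "x - y"] by (simp add: abs_mult mult_right_mono)
    then show "J (x - y) * rep_L1 g y \<le> B * \<bar>rep_L1 g y\<bar>" for y
      using abs_le_D1 by blast
    show "integrable lborel (\<lambda>y. J (x - y) * rep_L1 g y)"
    proof (rule Bochner_Integration.integrable_bound)
      show "integrable lborel (\<lambda>y. B * \<bar>rep_L1 g y\<bar>)"
        by (simp add: integrable_rep_L1)
      show "AE y in lborel. norm (J (x - y) * rep_L1 g y) \<le> norm (B * \<bar>rep_L1 g y\<bar>)"
        using le by (intro AE_I2) (metis abs_ge_self order_trans real_norm_def)
    qed measurable
  qed (simp add: integrable_rep_L1)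
  then show ?case
    using elim by (simp add: norm_L1_rep)
qed

text \<open>If \<open>x\<close> lies outside the Minkowski sum, then for each \<open>y\<close>
  either \<open>y\<close> is not in \<open>K\<close> or \<open>x - y\<close> is not in
  \<open>S\<close>, so the integrand vanishes for almost every \<open>y\<close>.\<close>

lemma rep_L1_conv_eq_0:
  assumes J: "integrable lborel J" and S: "\<And>x. x \<notin> S \<Longrightarrow> J x = 0"
    and g: "AE x in lborel. x \<notin> K \<longrightarrow> rep_L1 g x = 0"
  shows "AE x in lborel. x \<notin> {y + z |y z. y \<in> K \<and> z \<in> S} \<longrightarrow> rep_L1 (L1_of J \<star> g) x = 0"
  using rep_L1_conv[OF J, of g]
proof eventually_elim
  case (elim x)
  have "(\<integral>y. J (x - y) * rep_L1 g y \<partial>lborel) = 0" if x: "x \<notin> {y + z |y z. y \<in> K \<and> z \<in> S}"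
  proof (rule integral_eq_zero_AE)
    have "x - y \<notin> S" if "y \<in> K" for y
    proof
      assume "x - y \<in> S"
      moreover have "x = y + (x - y)"
        by simp
      ultimately show False
        using x that by blast
    qed
    with g show "AE y in lborel. J (x - y) * rep_L1 g y = 0"
      by (auto elim!: eventually_mono intro: S)
  qed
  with elim show ?case by simp
qed

section \<open>Pointwise bounds on integrals of \<open>L\<^sup>1\<close>-valued functions\<close>

lemma integrable_indicator_rep_L1:
  assumes [measurable]: "A \<in> sets borel"
  shows "integrable lborel (\<lambda>x. indicator A x * rep_L1 f x)"
  using integrable_mult_indicator[OF _ integrable_rep_L1, of A f] by simp

text \<open>Integrals over \<open>A\<close> do not see the choice of representative, so this is a
  linear functional on classes, of norm at most 1.\<close>

lemma bounded_linear_integral_indicator: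
  assumes A[measurable]: "A \<in> sets borel"
  shows "bounded_linear (\<lambda>f. \<integral>x. indicator A x * rep_L1 f x \<partial>lborel)"
proof (rule bounded_linear_intro[where K = 1])
  fix f g :: "'a L1" and r :: real
  have "(\<integral>x. indicator A x * rep_L1 (f + g) x \<partial>lborel) =
      (\<integral>x. indicator A x * rep_L1 f x + indicator A x * rep_L1 g x \<partial>lborel)"
    using rep_L1_add[of f g]
    by (intro integral_cong_AE) (auto simp: algebra_simps elim!: eventually_mono)
  then show "(\<integral>x. indicator A x * rep_L1 (f + g) x \<partial>lborel) =
      (\<integral>x. indicator A x * rep_L1 f x \<partial>lborel) + (\<integral>x. indicator A x * rep_L1 g x \<partial>lborel)"
    by (simp add: integrable_indicator_rep_L1[OF A])
  have "(\<integral>x. indicator A x * rep_L1 (r *\<^sub>R f) x \<partial>lborel) =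
      (\<integral>x. r * (indicator A x * rep_L1 f x) \<partial>lborel)"
    using rep_L1_scaleR[of r f]
    by (intro integral_cong_AE) (auto elim!: eventually_mono)
  then show "(\<integral>x. indicator A x * rep_L1 (r *\<^sub>R f) x \<partial>lborel) =
      r *\<^sub>R (\<integral>x. indicator A x * rep_L1 f x \<partial>lborel)"
    by simp
  have "norm (\<integral>x. indicator A x * rep_L1 f x \<partial>lborel) \<le> (\<integral>x. norm (indicator A x * rep_L1 f x) \<partial>lborel)"
    by (rule integral_norm_bound)
  also have "\<dots> \<le> (\<integral>x. \<bar>rep_L1 f x\<bar> \<partial>lborel)"
    by (rule integral_mono)
      (use integrable_norm[OF integrable_indicator_rep_L1[OF A, of f]] integrable_rep_L1[of f]
        in \<open>auto simp: indicator_def\<close>)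
  finally show "norm (\<integral>x. indicator A x * rep_L1 f x \<partial>lborel) \<le> norm f * 1"
    by (simp add: norm_L1_rep)
qed

text \<open>The exceptional null set of the bound on \<open>F s\<close> may depend on \<open>s\<close>, so the bound is tested
  against the functionals \<open>f \<mapsto> \<integral>\<^sub>A f\<close>, which commute with the integral in time.\<close>

lemma rep_L1_integral_le:
  fixes F :: "real \<Rightarrow> 'a::euclidean_space L1"
  assumes F: "F integrable_on {a..b}" and ab: "a \<le> b" and E[measurable]: "E \<in> sets borel"
    and le: "\<And>s. s \<in> {a..b} \<Longrightarrow> AE x in lborel. x \<in> E \<longrightarrow> rep_L1 (F s) x \<le> c"
  shows "AE x in lborel. x \<in> E \<longrightarrow> rep_L1 (integral {a..b} F) x \<le> (b - a) * c"
proof -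
  define I where "I = rep_L1 (integral {a..b} F)"
  have [measurable]: "I \<in> borel_measurable borel"
    by (simp add: I_def)
  \<comment> \<open>Intersecting with balls makes the measure finite, so that constants are
    integrable there; countably many balls cover the space.\<close>
  have "AE x in lborel. x \<in> E \<inter> ball 0 (real n) \<longrightarrow> I x \<le> (b - a) * c" for n
  proof -
    \<comment> \<open>The part of the ball where the claimed bound fails; testing against it will
      show that it is null.\<close>
    define A where "A = E \<inter> ball 0 (real n) \<inter> {x. (b - a) * c < I x}"
    have "{x. (b - a) * c < I x} \<in> sets borel"
      using borel_measurable_less[of "\<lambda>_. (b - a) * c" borel I] by simp
    then have A[measurable]: "A \<in> sets borel"
      unfolding A_def by auto
    have "emeasure lborel A \<le> emeasure lborel (ball (0::'a) (real n))"
      by (rule emeasure_mono) (auto simp: A_def)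
    then have fin: "emeasure lborel A < \<infinity>"
      using emeasure_lborel_ball_finite[of "0::'a" "real n"] by (meson le_less_trans)
    have int_A: "integrable lborel (\<lambda>x. d * indicator A x)" for d :: real
      using fin by (intro integrable_mult_right) auto
    let ?\<phi> = "\<lambda>f. \<integral>x. indicator A x * rep_L1 f x \<partial>lborel"
    have bl: "bounded_linear ?\<phi>"
      by (rule bounded_linear_integral_indicator[OF A])
    have le_\<phi>: "?\<phi> (F s) \<le> c * measure lborel A" if "s \<in> {a..b}" for s
    proof -
      have "?\<phi> (F s) \<le> (\<integral>x. c * indicator A x \<partial>lborel)"
        using le[OF that]
        by (intro integral_mono_AE integrable_indicator_rep_L1[OF A] int_A)
          (auto simp: A_def indicator_def elim!: eventually_mono)
      then show ?thesis
        by simp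
    qed
    have "?\<phi> (integral {a..b} F) = integral {a..b} (?\<phi> \<circ> F)"
      using integral_linear[OF F bl] by simp
    also have "\<dots> \<le> integral {a..b} (\<lambda>_. c * measure lborel A)"
      using le_\<phi> by (intro integral_le integrable_linear[OF F bl]) auto
    finally have "?\<phi> (integral {a..b} F) \<le> (\<integral>x. ((b - a) * c) * indicator A x \<partial>lborel)"
      using ab by (simp add: mult.assoc mult.left_commute)
    then have "(\<integral>x. indicator A x * I x - ((b - a) * c) * indicator A x \<partial>lborel) \<le> 0"
      using integrable_indicator_rep_L1[OF A] int_A by (simp add: I_def)
    moreover have int: "integrable lborel (\<lambda>x. indicator A x * I x - ((b - a) * c) * indicator A x)"
      using integrable_indicator_rep_L1[OF A] int_A unfolding I_def
      by (intro Bochner_Integration.integrable_diff) auto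
    \<comment> \<open>The integrand is strictly positive on \<open>A\<close> and 0 elsewhere, so an
      integral that is at most 0 forces \<open>A\<close> to be null.\<close>
    moreover have nonneg: "0 \<le> indicator A x * I x - ((b - a) * c) * indicator A x" for x
      by (auto simp: A_def indicator_def)
    ultimately have "(\<integral>x. indicator A x * I x - ((b - a) * c) * indicator A x \<partial>lborel) = 0"
      by (intro antisym integral_nonneg_AE AE_I2)
    then have "AE x in lborel. indicator A x * I x - ((b - a) * c) * indicator A x = 0"
      using integral_nonneg_eq_0_iff_AE[OF int] nonneg by simp
    then show ?thesis
      by eventually_elim (auto simp: A_def indicator_def split: if_splits)
  qed
  then have "AE x in lborel. \<forall>n. x \<in> E \<inter> ball 0 (real n) \<longrightarrow> I x \<le> (b - a) * c"
    unfolding AE_all_countable by blast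
  then show ?thesis
    unfolding I_def[symmetric]
    by eventually_elim (metis IntI mem_ball_0 reals_Archimedean2)
qed

text \<open>The upper bound with constant 0, applied to \<open>F\<close> and to
  \<open>- F\<close>.\<close>

lemma rep_L1_integral_eq_0:
  fixes F :: "real \<Rightarrow> 'a::euclidean_space L1"
  assumes F: "F integrable_on {a..b}" and ab: "a \<le> b" and E: "E \<in> sets borel"
    and eq: "\<And>s. s \<in> {a..b} \<Longrightarrow> AE x in lborel. x \<in> E \<longrightarrow> rep_L1 (F s) x = 0"
  shows "AE x in lborel. x \<in> E \<longrightarrow> rep_L1 (integral {a..b} F) x = 0"
proof -
  have minus: "AE x in lborel. rep_L1 (- f) x = - rep_L1 f x" for f :: "'a L1"
    using rep_L1_scaleR[of "-1" f] by simp
  have "AE x in lborel. x \<in> E \<longrightarrow> rep_L1 (integral {a..b} F) x \<le> (b - a) * 0"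
  proof (rule rep_L1_integral_le[OF F ab E])
    show "AE x in lborel. x \<in> E \<longrightarrow> rep_L1 (F s) x \<le> 0" if "s \<in> {a..b}" for s
      using eq[OF that] by eventually_elim simp
  qed
  moreover have "AE x in lborel. x \<in> E \<longrightarrow> rep_L1 (integral {a..b} (\<lambda>s. - F s)) x \<le> (b - a) * 0"
  proof (rule rep_L1_integral_le[OF integrable_neg[OF F] ab E])
    show "AE x in lborel. x \<in> E \<longrightarrow> rep_L1 (- F s) x \<le> 0" if "s \<in> {a..b}" for s
      using eq[OF that] minus[of "F s"] by eventually_elim simp
  qed
  ultimately show ?thesis
    using minus[of "integral {a..b} F"] by eventually_elim auto
qed

section \<open>Propagation of the support\<close>

text \<open>The complement of \<open>K\<close> is an open set on which \<open>f\<close> vanishes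
  a.e., so the support is a closed subset of \<open>K\<close>.\<close>

lemma compact_L1_support:
  assumes K: "compact K" and f: "AE x in lborel. x \<notin> K \<longrightarrow> rep_L1 f x = 0"
  shows "compact (L1_support f)"
proof -
  have "- K \<subseteq> - ae_support (rep_L1 f)"
    unfolding ae_support_def using compact_imp_closed[OF K] f by (auto intro!: exI[of _ "- K"])
  moreover have "closed (ae_support (rep_L1 f))"
    by (simp add: closed_def ae_support_vanishes(1))
  moreover have "L1_support f = ae_support (rep_L1 f)"
    using L1_support.abs_eq[of "rep_L1 f"] by (simp add: L1_rel_def integrable_rep_L1 L1_of_rep)
  ultimately show ?thesis
    using compact_Int_closed[OF K, of "L1_support f"] by (simp add: Int_absorb1)
qed

lemma rep_L1_eq_0_off_support: "AE x in lborel. x \<notin> L1_support f \<longrightarrow> rep_L1 f x = 0"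
  using ae_support_vanishes(2)[of "rep_L1 f"] L1_support.abs_eq[of "rep_L1 f"]
  by (simp add: L1_rel_def integrable_rep_L1 L1_of_rep)

text \<open>The condition on \<open>b - a\<close> involves only \<open>B\<close> and
  \<open>M\<close>, not \<open>K\<close>, so the step can be repeated with the same length although
  the compact set grows.\<close>

lemma stefan_step:
  fixes J :: "'a::euclidean_space \<Rightarrow> real" and u :: "real \<Rightarrow> 'a L1"
  defines "F \<equiv> \<lambda>s. L1_of J \<star> temperature (u s) - temperature (u s)"
  assumes J: "integrable lborel J" and B: "\<And>x. \<bar>J x\<bar> \<le> B"
    and S: "compact S" "\<And>x. x \<notin> S \<Longrightarrow> J x = 0"
    and F: "F integrable_on {a..b}" and ab: "a \<le> b"
    and eq: "\<And>t. t \<in> {a..b} \<Longrightarrow> u t = u a + integral {a..t} F"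
    and M: "\<And>s. s \<in> {a..b} \<Longrightarrow> norm (u s) \<le> M" and small: "(b - a) * (B * M) \<le> 1"
    and K: "compact K" and ua: "AE x in lborel. x \<notin> K \<longrightarrow> rep_L1 (u a) x = 0"
  obtains L where "compact L" "AE x in lborel. x \<notin> L \<longrightarrow> rep_L1 (u b) x = 0"
proof -
  have B0: "0 \<le> B"
    using B[of 0] by linarith
  have "0 \<le> M"
    using order_trans[OF norm_ge_zero M[of a]] ab by simp
  have E[measurable]: "- K \<in> sets borel"
    using compact_imp_closed[OF K] by auto
  have F_le: "AE x in lborel. x \<in> - K \<longrightarrow> rep_L1 (F s) x \<le> B * M" if s: "s \<in> {a..b}" for s
    using rep_L1_conv_le[OF J B, of "temperature (u s)"] rep_L1_temperature[of "u s"]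
      rep_L1_diff[of "L1_of J \<star> temperature (u s)" "temperature (u s)"]
  proof eventually_elim
    case (elim x)
    have "B * norm (temperature (u s)) \<le> B * M"
      using norm_temperature_le[of "u s"] M[OF s] B0 by (intro mult_left_mono) auto
    with elim show ?case
      unfolding F_def by auto
  qed
  have v0: "AE x in lborel. x \<notin> K \<longrightarrow> rep_L1 (temperature (u s)) x = 0" if s: "s \<in> {a..b}" for s
  proof -
    have le: "AE x in lborel. x \<in> - K \<longrightarrow> rep_L1 (integral {a..s} F) x \<le> (s - a) * (B * M)"
    proof (rule rep_L1_integral_le)
      show "F integrable_on {a..s}"
        by (rule integrable_on_subinterval[OF F]) (use s in auto)
    qed (use s F_le E in auto)
    have "(s - a) * (B * M) \<le> (b - a) * (B * M)"
      using s B0 \<open>0 \<le> M\<close> by (intro mult_right_mono) auto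
    \<comment> \<open>Equality is allowed, as the temperature is still 0 at the value 1.\<close>
    then have frozen: "(s - a) * (B * M) \<le> 1"
      using small by linarith
    show ?thesis
      using le ua rep_L1_temperature[of "u s"] rep_L1_add[of "u a" "integral {a..s} F"]
      unfolding eq[OF s, symmetric] by eventually_elim (use frozen in auto)
  qed
  \<comment> \<open>\<open>S\<close> need not contain 0, so \<open>K\<close> itself has to be added
    to the sum.\<close>
  define L where "L = K \<union> {y + z |y z. y \<in> K \<and> z \<in> S}"
  have L: "compact L"
    unfolding L_def by (intro compact_Un K compact_sums S)
  have "AE x in lborel. x \<in> - L \<longrightarrow> rep_L1 (integral {a..b} F) x = 0"
  proof (rule rep_L1_integral_eq_0[OF F ab])
    show "- L \<in> sets borel"
      using compact_imp_closed[OF L] by auto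
    show "AE x in lborel. x \<in> - L \<longrightarrow> rep_L1 (F s) x = 0" if "s \<in> {a..b}" for s
    proof -
      have "AE x in lborel. x \<notin> {y + z |y z. y \<in> K \<and> z \<in> S} \<longrightarrow>
          rep_L1 (L1_of J \<star> temperature (u s)) x = 0"
        using J S(2) v0[OF that] by (rule rep_L1_conv_eq_0)
      with v0[OF that] rep_L1_diff[of "L1_of J \<star> temperature (u s)" "temperature (u s)"]
      show ?thesis
        unfolding F_def L_def by eventually_elim auto
    qed
  qed
  then have "AE x in lborel. x \<notin> L \<longrightarrow> rep_L1 (u b) x = 0"
    using ua rep_L1_add[of "u a" "integral {a..b} F"] eq[of b] ab
    by (auto simp: L_def elim!: eventually_elim2)
  with L show thesis
    by (rule that)
qed

text \<open>The equation is assumed only for positive times; \<open>u\<close> minus the integral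
  term is continuous on \<open>{0..T}\<close> and equals \<open>f\<close> on \<open>{0<..T}\<close>,
  hence also at 0.\<close>

lemma L1_solution_initial:
  assumes u: "L1_solution J f u" and "T > 0"
    and F: "(\<lambda>s. L1_of J \<star> temperature (u s) - temperature (u s)) integrable_on {0..T}"
      (is "?F integrable_on _")
  shows "u 0 = f"
proof -
  have cl: "closure {0<..T} = {0..T}"
    using \<open>T > 0\<close> by simp
  let ?g = "\<lambda>t. u t - integral {0..t} ?F"
  have "?g 0 = f"
  proof (rule continuous_constant_on_closure[where S = "{0<..T}" and f = ?g])
    show "continuous_on (closure {0<..T}) ?g"
      unfolding cl using u
      by (intro continuous_on_diff indefinite_integral_continuous_1[OF F])
        (auto simp: L1_solution_def intro: continuous_on_subset)
  qed (use u \<open>T > 0\<close> in \<open>auto simp: L1_solution_def cl\<close>)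
  then show ?thesis
    by simp
qed

section \<open>Iteration over finitely many equal time steps\<close>

lemma L1_solution_vanishes_off_compact:
  fixes J :: "'a::euclidean_space \<Rightarrow> real"
  assumes J: "integrable lborel J" and B: "\<And>x. \<bar>J x\<bar> \<le> B"
    and S: "compact S" "\<And>x. x \<notin> S \<Longrightarrow> J x = 0"
    and f: "compact (L1_support f)" and u: "L1_solution J f u" and "T > 0"
  obtains K where "compact K" "AE x in lborel. x \<notin> K \<longrightarrow> rep_L1 (u T) x = 0"
proof -
  define F where "F = (\<lambda>s. L1_of J \<star> temperature (u s) - temperature (u s))"
  have ut: "u t = f + integral {0..t} F" if "t > 0" for t
    using u that by (simp add: L1_solution_def F_def)
  show thesis
  proof (cases "F integrable_on {0..T}")
    case False
    \<comment> \<open>Cannot happen, but then the integral is \<open>0\<close> by convention, which saves proving continuity of \<open>F\<close>.\<close>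
    then have "u T = f"
      using ut[OF \<open>T > 0\<close>] by (simp add: not_integrable_integral)
    then show thesis
      using that[OF f] rep_L1_eq_0_off_support[of f] by simp
  next
    case True
    have u0: "u 0 = f"
      using L1_solution_initial[OF u \<open>T > 0\<close>] True by (simp add: F_def)
    have F_int: "F integrable_on {a..b}" if "0 \<le> a" "b \<le> T" for a b
      by (rule integrable_on_subinterval[OF True]) (use that in auto)
    \<comment> \<open>Difference of the equations at \<open>t\<close> and \<open>a\<close>;
      \<open>u 0 = f\<close> supplies the equation at time 0.\<close>
    have eq: "u t = u a + integral {a..t} F" if "0 \<le> a" "a \<le> t" "t \<le> T" for a t
    proof -
      have "u s = f + integral {0..s} F" if "0 \<le> s" for s
        using ut[of s] u0 that by (cases "s = 0") auto
      moreover have "integral {0..t} F = integral {0..a} F + integral {a..t} F"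
        using that
        by (intro Henstock_Kurzweil_Integration.integral_combine[symmetric] F_int) auto
      ultimately show ?thesis
        using that by simp
    qed
    have "compact (u ` {0..T})"
      using u by (intro compact_continuous_image)
        (auto simp: L1_solution_def intro: continuous_on_subset)
    from compact_imp_bounded[OF this]
    obtain M where M: "\<And>s. s \<in> {0..T} \<Longrightarrow> norm (u s) \<le> M"
      unfolding bounded_iff by blast
    \<comment> \<open>Steps of length \<open>T / n\<close> then meet the smallness condition of
      \<open>stefan_step\<close>; the maximum with 0 gives \<open>n > 0\<close> directly.\<close>
    obtain n :: nat where n: "max 0 (T * (B * M)) < real n"
      using reals_Archimedean2 by blast
    define h where "h = T / real n"
    have "n > 0"
      using n by (intro gr0I) auto
    then have h: "h > 0" "real n * h = T" "h * (B * M) \<le> 1"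
      using n \<open>T > 0\<close> by (auto simp: h_def field_simps)
    have "\<exists>K. compact K \<and> (AE x in lborel. x \<notin> K \<longrightarrow> rep_L1 (u (real k * h)) x = 0)"
      if "k \<le> n" for k
      using that
    proof (induction k)
      case 0
      then show ?case
        using f rep_L1_eq_0_off_support[of f] u0 by auto
    next
      case (Suc k)
      then obtain K where K: "compact K"
          "AE x in lborel. x \<notin> K \<longrightarrow> rep_L1 (u (real k * h)) x = 0"
        by auto
      have ge: "0 \<le> real k * h" "real k * h \<le> real (Suc k) * h"
        using h by (auto intro: mult_right_mono)
      \<comment> \<open>The step must end by \<open>T\<close>, since \<open>M\<close> and the
        integrability of \<open>F\<close> are known only up to there.\<close>
      have "real (Suc k) * h \<le> real n * h"
        using Suc.prems h by (intro mult_right_mono) auto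
      then have le: "real (Suc k) * h \<le> T"
        using h by simp
      obtain L where "compact L" "AE x in lborel. x \<notin> L \<longrightarrow> rep_L1 (u (real (Suc k) * h)) x = 0"
      proof (rule stefan_step[where u = u and a = "real k * h" and b = "real (Suc k) * h" and M = M,
            OF J B S _ ge(2) _ _ _ K, folded F_def])
        show "F integrable_on {real k * h..real (Suc k) * h}"
          using ge le by (intro F_int)
        show "u t = u (real k * h) + integral {real k * h..t} F"
          if "t \<in> {real k * h..real (Suc k) * h}" for t
          using that ge le by (intro eq) auto
        show "norm (u s) \<le> M" if "s \<in> {real k * h..real (Suc k) * h}" for s
          using that ge le by (intro M) auto
        show "(real (Suc k) * h - real k * h) * (B * M) \<le> 1"
          using h(3) by (simp add: algebra_simps)
      qed
      then show ?case
        by blast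
    qed
    from this[of n] show thesis
      using that h(2) by auto
  qed
qed

theorem theorem3p2:
  fixes J :: "real ^ 'n \<Rightarrow> real"
    and f :: "(real ^ 'n) L1"
    and u :: "real \<Rightarrow> (real ^ 'n) L1"
    and t :: real
  assumes "continuous_on UNIV J"
    and "\<forall>x. 0 \<le> J x"
    and "compact (ae_support J)"
    and "\<forall>x y. norm x = norm y \<longrightarrow> J x = J y"
    and "(\<integral>x. J x \<partial>lborel) = 1"
    and "L1_nonneg f"
    and "compact (L1_support f)"
    and "L1_solution J f u"
    and "t > 0"
  shows "compact (L1_support (u t)) \<and> compact (L1_support (temperature (u t)))"
proof -
  \<comment> \<open>A function that is not integrable would have integral 0 by convention, not
    1.\<close>
  have J: "integrable lborel J"
    using assms(5) not_integrable_integral_eq by fastforce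
  \<comment> \<open>Continuity makes the support the closure of the nonzero set, so \<open>J\<close>
    vanishes at every point off it, not just almost everywhere.\<close>
  have S: "J x = 0" if "x \<notin> ae_support J" for x
    using that closure_subset[of "{x. J x \<noteq> 0}"] by (auto simp: ae_support_continuous[OF assms(1)])
  have "compact (J ` ae_support J)"
    by (intro compact_continuous_image continuous_on_subset[OF assms(1)] assms(3)) auto
  from compact_imp_bounded[OF this]
  obtain B where "\<And>x. x \<in> ae_support J \<Longrightarrow> \<bar>J x\<bar> \<le> B"
    unfolding bounded_iff by auto
  \<comment> \<open>\<open>B\<close> bounds \<open>J\<close> on the support only and has no known
    sign, whereas \<open>J\<close> is 0 elsewhere.\<close>
  then have B: "\<bar>J x\<bar> \<le> max 0 B" for x
    using S[of x] by (cases "x \<in> ae_support J") (simp_all add: max.coboundedI2)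
  obtain K where K: "compact K" "AE x in lborel. x \<notin> K \<longrightarrow> rep_L1 (u t) x = 0"
    using L1_solution_vanishes_off_compact[OF J B assms(3) S assms(7,8,9)] by metis
  \<comment> \<open>Where \<open>u t\<close> is 0, the temperature is
    \<open>max (0 - 1) 0 = 0\<close>, so the same \<open>K\<close> carries it.\<close>
  have "AE x in lborel. x \<notin> K \<longrightarrow> rep_L1 (temperature (u t)) x = 0"
    using K(2) rep_L1_temperature[of "u t"] by eventually_elim auto
  with K show ?thesis
    by (simp add: compact_L1_support)
qed

end
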